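(* Let $n\ge 1$ and let $\pi=\pi_1\pi_2\cdots\pi_n\in\mathcal{S}_n$ have left border numbers $a_1,a_2,\ldots,a_n$. Let $a$ be the sequence obtained by arranging $a_2,a_3,\ldots,a_n$ in (weakly) decreasing order. Then $\Lambda(\pi)=a$.
   Context: $\mathcal{S}_n$ is the set of permutations $\pi=\pi_1\cdots\pi_n$ of $[n]=\{1,\ldots,n\}$, written as words. The standardization $w^{\ast}$ of a word $w$ of $m$ distinct positive integers is the permutation in $\mathcal{S}_m$ obtained by replacing the $i$th smallest letter by $i$. The map $D$ from permutations in $\mathcal{S}_n$ to Dyck words of length $2n$ in the letters $\mathsf{u}$ (up step $(0,1)$) and $\mathsf{r}$ (right step $(1,0)$) is defined recursively by $D(\emptyset)=\emptyset$ and, for $\pi=\pi_L\,n\,\pi_R\in\mathcal{S}_n$ with $n\ge1$ ($\pi_L,\pi_R$ the possibly empty words to the left and right of the letter $n$), $D(\pi)=\mathsf{u}\,D(\pi_L^{\ast})\,\mathsf{r}\,D(\pi_R^{\ast})$. $\Lambda(\pi)$ is the partition with exactly $n-1$ parts (parts equal to $0$ allowed) whose Young diagram is the region above the path $D(\pi)$ drawn from $(0,0)$ to $(n,n)$, i.e. bounded by the path and the lines $x=0$, $y=n$. Equivalently, the parts of $\Lambda(\pi)$ are, in weakly decreasing order, the numbers of letters $\mathsf{r}$ preceding the 2nd, 3rd, ..., $n$th letter $\mathsf{u}$ in $D(\pi)$. Example: for $\pi=5\,3\,1\,4\,8\,2\,7\,6$, $\Lambda(\pi)=(7,5,5,2,1,1,0)$.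 The left border number $a_i$ of $\pi$ is the largest position $m<i$ with $\pi_m>\pi_i$, or $0$ if no such position exists. *)

theory Defs
  imports "HOL-Combinatorics.Multiset_Permutations"
begin

text \<open>
  Permutations of \<open>[n]\<close> are words, i.e. the elements of
  \<^term>\<open>permutations_of_set {1..n::nat}\<close>.
  Letters of a word carry the positions \<open>1, ..., n\<close>, whereas list indices start at \<open>0\<close>.
\<close>

definition letter :: "nat list \<Rightarrow> nat \<Rightarrow> nat" where
  "letter \<pi> i = \<pi> ! (i - 1)"

definition standardize :: "nat list \<Rightarrow> nat list" where
  "standardize w = map (\<lambda>x. card {y \<in> set w. y \<le> x}) w"

lemma length_standardize [simp]: "length (standardize w) = length w"
  by (simp add: standardize_def)

definition left_border :: "nat list \<Rightarrow> nat \<Rightarrow> nat" where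
  "left_border \<pi> i = Max (insert 0 {m. 1 \<le> m \<and> m < i \<and> letter \<pi> m > letter \<pi> i})"

datatype step = U | R

lemma length_takeWhile_neq_less: "x \<in> set w \<Longrightarrow> length (takeWhile (\<lambda>y. y \<noteq> x) w) < length w"
  by (induction w) auto

text \<open>
  For a permutation of \<open>[n]\<close> with \<open>n \<ge> 1\<close> the letter \<open>n\<close> is the largest one;
  using \<^const>\<open>Max\<close> makes the recursion terminate on arbitrary words.
\<close>

function dyck_word :: "nat list \<Rightarrow> step list" where
  "dyck_word \<pi> =
     (if \<pi> = [] then []
      else let n = Max (set \<pi>);
               \<pi>L = takeWhile (\<lambda>x. x \<noteq> n) \<pi>;
               \<pi>R = tl (dropWhile (\<lambda>x. x \<noteq> n) \<pi>)
           in [U] @ dyck_word (standardize \<pi>L) @ [R] @ dyck_word (standardize \<pi>R))"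
  by auto
termination
proof (relation "measure length", goal_cases)
  case (2 \<pi> n \<pi>L \<pi>R)
  have "n \<in> set \<pi>"
    using 2 by (metis List.finite_set Max_in set_empty)
  then show ?case
    using 2 by (simp add: length_takeWhile_neq_less)
next
  case (3 \<pi> n \<pi>L \<pi>R)
  have "length (dropWhile (\<lambda>x. x \<noteq> n) \<pi>) \<le> length \<pi>"
    by (rule length_dropWhile_le)
  with 3 show ?case
    by (cases \<pi>) auto
qed simp

declare dyck_word.simps [simp del]

text \<open>
  The pair \<open>(x, y)\<close> stands for the unit square \<open>[x, x+1] \<times> [y, y+1]\<close>.
  A path of up steps and right steps starting at \<open>(0,0)\<close> has exactly one right step
  over \<open>[x, x+1]\<close> for each \<open>x\<close> below its number of right steps, at height the number of
  preceding up steps; the square lies above the path iff this height is at most \<open>y\<close>.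
  The line \<open>y = n\<close> bounds the region from above.
\<close>

definition cells_above :: "step list \<Rightarrow> (nat \<times> nat) set" where
  "cells_above w = {(x, y). y < count_list w U \<and>
     (\<exists>k < length w. w ! k = R \<and> count_list (take k w) R = x \<and> count_list (take k w) U \<le> y)}"

text \<open>
  The parts are the row lengths of the region, read from the top row \<open>y = n - 1\<close> down to
  the row \<open>y = 1\<close>. The row \<open>y = 0\<close> is not recorded; it is empty since the path starts with
  an up step.
\<close>

definition Lambda :: "nat list \<Rightarrow> nat list" where
  "Lambda \<pi> = map (\<lambda>y. card {x. (x, y) \<in> cells_above (dyck_word \<pi>)}) (rev [1..<length \<pi>])"

lemma count_list_take_Suc:
  "k < length w \<Longrightarrow> count_list (take (Suc k) w) a = count_list (take k w) a + (if w ! k = a then 1 else 0)"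
  by (simp add: take_Suc_conv_app_nth)

lemma count_list_take_mono: "j \<le> k \<Longrightarrow> count_list (take j w) a \<le> count_list (take k w) a"
  by (metis count_list_append le_add1 le_add_diff_inverse take_add)

lemma ex_step_of_count:
  assumes "k \<le> length w" "x < count_list (take k w) a"
  shows "\<exists>j<k. w ! j = a \<and> count_list (take j w) a = x"
  using assms
proof (induction k)
  case (Suc k)
  then show ?case
    by (cases "x < count_list (take k w) a")
       (auto simp: count_list_take_Suc less_Suc_eq split: if_splits)
qed simp

text \<open>
  The row at height \<open>y\<close> consists of as many squares as there are letters \<^const>\<open>R\<close>
  before the \<open>(y+1)\<close>st letter \<^const>\<open>U\<close>.
\<close>

lemma card_row_cells_above:
  assumes k: "k < length w" "w ! k = U" "count_list (take k w) U = y"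
  shows "card {x. (x, y) \<in> cells_above w} = count_list (take k w) R"
proof -
  have le: "count_list (take j w) a \<le> count_list w a" for j a
    by (metis append_take_drop_id count_list_append le_add1)
  have y: "y < count_list w U"
    using count_list_take_Suc[OF k(1), of U] le[of "Suc k" U] k by simp
  have "{x. (x, y) \<in> cells_above w} = {..<count_list (take k w) R}"
  proof (intro equalityI subsetI)
    fix x assume "x \<in> {x. (x, y) \<in> cells_above w}"
    then obtain j where j: "j < length w" "w ! j = R" "count_list (take j w) R = x"
        "count_list (take j w) U \<le> y"
      by (auto simp: cells_above_def)
    have "\<not> k < j"
      using count_list_take_mono[of "Suc k" j w U] count_list_take_Suc[OF k(1), of U] k j by auto
    then have "j < k"
      using j k by (metis linorder_neqE_nat step.distinct(1))
    then show "x \<in> {..<count_list (take k w) R}"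
      using count_list_take_mono[of "Suc j" k w R] count_list_take_Suc[OF j(1), of R] j by auto
  next
    fix x assume "x \<in> {..<count_list (take k w) R}"
    then obtain j where j: "j < k" "w ! j = R" "count_list (take j w) R = x"
      using ex_step_of_count[of k w x R] k by auto
    then show "x \<in> {x. (x, y) \<in> cells_above w}"
      using y k count_list_take_mono[of j k w U]
      by (auto simp: cells_above_def intro!: exI[of _ j])
  qed
  then show ?thesis by simp
qed

end

theory Submission
  imports Defs
begin

text \<open>
  Record for each up step of a path the number of right steps before it. Along
  \<open>D(\<pi>) = u D(\<pi>\<^sub>L) r D(\<pi>\<^sub>R)\<close> this gives a \<open>0\<close>, then the record of \<open>D(\<pi>\<^sub>L)\<close>, then the record
  of \<open>D(\<pi>\<^sub>R)\<close> shifted by \<open>|\<pi>\<^sub>L| + 1\<close>. The left border numbers of \<open>\<pi>\<^sub>L n \<pi>\<^sub>R\<close> obey the same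
  recursion: those of \<open>\<pi>\<^sub>L\<close> are unchanged, that of \<open>n\<close> is \<open>0\<close>, and those of \<open>\<pi>\<^sub>R\<close> are shifted
  by the position \<open>|\<pi>\<^sub>L| + 1\<close> of \<open>n\<close>, which replaces the default value \<open>0\<close>. Hence the two
  multisets agree, and the record of a path is weakly increasing.
\<close>

section \<open>Right steps before the up steps of a path\<close>

fun rights_before :: "step list \<Rightarrow> nat list" where
  "rights_before [] = []"
| "rights_before (U # w) = 0 # rights_before w"
| "rights_before (R # w) = map Suc (rights_before w)"

text \<open>All right steps of \<open>v\<close> precede every up step of \<open>w\<close>, hence the
  uniform shift.\<close>

lemma rights_before_append:
  "rights_before (v @ w) = rights_before v @ map ((+) (count_list v R)) (rights_before w)"
  by (induction v rule: rights_before.induct) (auto simp: map_idI)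

lemma sorted_rights_before: "sorted (rights_before w)"
  by (induction w rule: rights_before.induct) (auto simp: sorted_map)

text \<open>Locates the up step of index \<open>y\<close> in the form that
  \<open>card_row_cells_above\<close> needs to read off the length of row \<open>y\<close>.\<close>

lemma ex_nth_rights_before:
  assumes "y < length (rights_before w)"
  shows "\<exists>k < length w. w ! k = U \<and> count_list (take k w) U = y \<and>
    count_list (take k w) R = rights_before w ! y"
  using assms
proof (induction w arbitrary: y rule: rights_before.induct)
  case 1
  then show ?case by simp
next
  case (2 w)
  show ?case
  proof (cases y)
    case 0
    then show ?thesis by (intro exI[of _ 0]) simp
  next
    case (Suc z)
    with 2 obtain k where "k < length w" "w ! k = U" "count_list (take k w) U = z"
        "count_list (take k w) R = rights_before w ! z"
      by auto
    with Suc show ?thesis by (intro exI[of _ "Suc k"]) simp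
  qed
next
  case (3 w)
  then obtain k where "k < length w" "w ! k = U" "count_list (take k w) U = y"
      "count_list (take k w) R = rights_before w ! y"
    by auto
  with 3 show ?case by (intro exI[of _ "Suc k"]) simp
qed

lemma card_row_eq_rights_before:
  assumes "y < length (rights_before w)"
  shows "card {x. (x, y) \<in> cells_above w} = rights_before w ! y"
  using ex_nth_rights_before[OF assms] card_row_cells_above by metis

section \<open>Standardization and relative order\<close>

lemma standardize_less_iff:
  assumes "i < length w" "j < length w"
  shows "standardize w ! i < standardize w ! j \<longleftrightarrow> w ! i < w ! j"
proof -
  have le: "card {y \<in> set w. y \<le> a} \<le> card {y \<in> set w. y \<le> b}" if "a \<le> b" for a b
    using that by (intro card_mono) auto
  have less: "card {y \<in> set w. y \<le> a} < card {y \<in> set w. y \<le> b}"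
    if "a < b" "b \<in> set w" for a b
  proof (rule psubset_card_mono)
    \<comment> \<open>The letter \<open>b\<close> itself witnesses strictness: ranks strictly
      increase along the letters of \<open>w\<close>.\<close>
    have "b \<in> {y \<in> set w. y \<le> b} - {y \<in> set w. y \<le> a}"
      using that by simp
    moreover have "{y \<in> set w. y \<le> a} \<subseteq> {y \<in> set w. y \<le> b}"
      using that by auto
    ultimately show "{y \<in> set w. y \<le> a} \<subset> {y \<in> set w. y \<le> b}"
      by blast
  qed simp
  show ?thesis
    using assms le[of "w ! j" "w ! i"] less[of "w ! i" "w ! j"]
    by (auto simp: standardize_def not_less[symmetric] simp del: not_less)
qed

lemma distinct_standardize:
  assumes "distinct w"
  shows "distinct (standardize w)"
  using assms by (auto simp: distinct_conv_nth linorder_neq_iff standardize_less_iff)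

text \<open>Left border numbers depend only on comparisons between letters, and standardization
  preserves these.\<close>

lemma left_border_standardize:
  assumes "1 \<le> i" "i \<le> length w"
  shows "left_border (standardize w) i = left_border w i"
proof -
  have "{m. 1 \<le> m \<and> m < i \<and> letter (standardize w) m > letter (standardize w) i} =
      {m. 1 \<le> m \<and> m < i \<and> letter w m > letter w i}"
    using assms by (auto simp: letter_def standardize_less_iff)
  then show ?thesis by (simp add: left_border_def)
qed

section \<open>Left border numbers around the largest letter\<close>

lemma left_border_append:
  assumes "1 \<le> i" "i \<le> length v"
  shows "left_border (v @ w) i = left_border v i"
proof -
  have "{m. 1 \<le> m \<and> m < i \<and> letter (v @ w) m > letter (v @ w) i} =
      {m. 1 \<le> m \<and> m < i \<and> letter v m > letter v i}"
    using assms by (auto simp: letter_def nth_append)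
  then show ?thesis by (simp add: left_border_def)
qed

lemma left_border_max:
  assumes "\<forall>a\<in>set v. a < x"
  shows "left_border (v @ x # w) (Suc (length v)) = 0"
proof -
  have none: "{m. 1 \<le> m \<and> m < Suc (length v) \<and>
      letter (v @ x # w) m > letter (v @ x # w) (Suc (length v))} = {}"
  proof -
    have "v ! k < x" if "k < length v" for k
      using assms that by simp
    then show ?thesis
      by (auto simp: letter_def nth_append not_less less_imp_le)
  qed
  show ?thesis by (simp only: left_border_def none) simp
qed

text \<open>The letter \<open>x\<close> exceeds every letter of \<open>w\<close>, so its position is
  always a candidate and takes over the role of the default \<open>0\<close>; a later candidate is a
  shifted candidate in \<open>w\<close>.\<close>

lemma left_border_after_max:
  assumes "\<forall>a\<in>set w. a < x" "1 \<le> j" "j \<le> length w"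
  shows "left_border (v @ x # w) (Suc (length v) + j) = Suc (length v) + left_border w j"
proof -
  define A where "A = {m. 1 \<le> m \<and> m < j \<and> letter w m > letter w j}"
  define B where "B = {m. 1 \<le> m \<and> m < Suc (length v) + j \<and>
    letter (v @ x # w) m > letter (v @ x # w) (Suc (length v) + j)}"
  have letter_w: "letter (v @ x # w) (Suc (length v) + m) = letter w m" if "1 \<le> m" for m
    using that by (cases m) (auto simp: letter_def nth_append)
  have letter_x: "letter (v @ x # w) (Suc (length v)) = x"
    by (simp add: letter_def)
  have wj: "letter w j < x"
    using assms by (auto simp: letter_def)
  have fin: "finite A" "finite B"
    by (auto simp: A_def B_def)
  \<comment> \<open>The case \<open>m = 0\<close> is the position of \<open>x\<close>.\<close>
  have A: "Suc (length v) + m \<in> B" if "m \<in> insert 0 A" for m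
    using that wj assms letter_w letter_x by (auto simp: A_def B_def simp del: One_nat_def)
  \<comment> \<open>Positions up to that of \<open>x\<close> satisfy the bound trivially; only those
    inside \<open>w\<close> need \<open>A\<close>.\<close>
  have B: "m \<le> Suc (length v) + Max (insert 0 A)" if "m \<in> insert 0 B" for m
  proof (cases "m \<le> Suc (length v)")
    case False
    then obtain l where l: "m = Suc (length v) + l" "1 \<le> l"
      by (metis One_nat_def Suc_leI less_imp_add_positive not_le)
    with that letter_w[OF l(2)] letter_w[OF assms(2)] have "l \<in> A"
      by (auto simp: A_def B_def)
    with l fin show ?thesis by simp
  qed simp
  have "Max (insert 0 B) = Suc (length v) + Max (insert 0 A)"
  proof (rule Max_eqI)
    have "Max (insert 0 A) \<in> insert 0 A"
      using fin by (intro Max_in) auto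
    then show "Suc (length v) + Max (insert 0 A) \<in> insert 0 B"
      using A by blast
  qed (use fin B in auto)
  then show ?thesis
    by (simp add: left_border_def A_def B_def)
qed

text \<open>Position \<open>1\<close> is included, so that the recursion holds for whole lists; its
  entry \<open>0\<close> is split off at the end.\<close>

definition left_borders :: "nat list \<Rightarrow> nat list" where
  "left_borders w = map (left_border w) [1..<Suc (length w)]"

lemma length_left_borders: "length (left_borders w) = length w"
  by (simp add: left_borders_def del: upt_Suc)

lemma left_borders_standardize: "left_borders (standardize w) = left_borders w"
  by (auto simp: left_borders_def left_border_standardize)

lemma left_borders_split_max:
  assumes "\<forall>a\<in>set v. a < x" "\<forall>a\<in>set w. a < x"
  shows "left_borders (v @ x # w) =
    left_borders v @ 0 # map (\<lambda>k. Suc (length v + k)) (left_borders w)"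
proof (rule nth_equalityI)
  fix i
  assume "i < length (left_borders (v @ x # w))"
  then have i: "i < Suc (length v + length w)"
    by (simp add: length_left_borders)
  consider "i < length v" | "i = length v"
    | j where "i = Suc (length v) + j" "j < length w"
    using i by (metis less_imp_Suc_add linorder_neqE_nat nat_add_left_cancel_less add_Suc)
  then show "left_borders (v @ x # w) ! i =
      (left_borders v @ 0 # map (\<lambda>k. Suc (length v + k)) (left_borders w)) ! i"
  proof cases
    case 1
    then show ?thesis
      by (simp add: left_borders_def nth_append left_border_append del: upt_Suc)
  next
    case 2
    then show ?thesis
      by (simp add: left_borders_def nth_append left_border_max[OF assms(1)] del: upt_Suc)
  next
    case 3
    then show ?thesis
      \<comment> \<open>List index \<open>j\<close> in \<open>left_borders w\<close> belongs to
        position \<open>Suc j\<close>.\<close>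
      using left_border_after_max[OF assms(2), of "Suc j" v]
      by (simp add: left_borders_def nth_append del: upt_Suc)
  qed
qed (simp add: length_left_borders)

section \<open>Comparing the two recursions\<close>

lemma dyck_word_split_max:
  assumes "\<forall>a\<in>set v. a < x" "\<forall>a\<in>set w. a < x"
  shows "dyck_word (v @ x # w) =
    U # dyck_word (standardize v) @ R # dyck_word (standardize w)"
proof -
  have "Max (set (v @ x # w)) = x"
    using assms by (intro Max_eqI) (auto intro: less_imp_le)
  moreover have "takeWhile (\<lambda>y. y \<noteq> x) (v @ x # w) = v"
      "dropWhile (\<lambda>y. y \<noteq> x) (v @ x # w) = x # w"
    using assms by (auto simp: takeWhile_append dropWhile_append)
  ultimately show ?thesis
    by (subst dyck_word.simps) (simp add: Let_def del: set_append)
qed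

lemma distinct_split_max:
  fixes w :: "nat list"
  assumes "distinct w" "w \<noteq> []"
  obtains u x v where "w = u @ x # v" "\<forall>a\<in>set u. a < x" "\<forall>a\<in>set v. a < x"
proof -
  define x where "x = Max (set w)"
  have "x \<in> set w"
    using assms by (simp add: x_def)
  then obtain u v where w: "w = u @ x # v"
    by (metis split_list)
  have "a < x" if "a \<in> set u \<union> set v" for a
  proof -
    have "a \<in> set w" "a \<noteq> x"
      using that assms(1) by (auto simp: w)
    then show ?thesis
      by (simp add: x_def le_neq_implies_less)
  qed
  with w that show thesis by blast
qed

text \<open>The induction is on length because the recursion passes to standardized factors. The
  count of right steps is carried along since it is the shift in
  \<open>rights_before_append\<close>. Distinctness makes all other letters strictly smaller than
  the maximum and survives standardization.\<close>

lemma dyck_word_left_borders: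
  assumes "distinct \<pi>"
  shows "count_list (dyck_word \<pi>) R = length \<pi> \<and>
    mset (rights_before (dyck_word \<pi>)) = mset (left_borders \<pi>)"
  using assms
proof (induction \<pi> rule: length_induct)
  case (1 \<pi>)
  show ?case
  proof (cases "\<pi> = []")
    case True
    then show ?thesis
      by (simp add: dyck_word.simps left_borders_def)
  next
    case False
    with 1 obtain u x v where \<pi>: "\<pi> = u @ x # v" and
        less: "\<forall>a\<in>set u. a < x" "\<forall>a\<in>set v. a < x"
      by (metis distinct_split_max)
    have "distinct (standardize u)" "distinct (standardize v)"
      using 1 \<pi> by (auto intro: distinct_standardize)
    with 1 \<pi> have "count_list (dyck_word (standardize u)) R = length u"
      "count_list (dyck_word (standardize v)) R = length v"
      "mset (rights_before (dyck_word (standardize u))) = mset (left_borders u)"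
      "mset (rights_before (dyck_word (standardize v))) = mset (left_borders v)"
      by (simp_all add: left_borders_standardize)
    then show ?thesis
      using less
      by (simp add: \<pi> dyck_word_split_max left_borders_split_max rights_before_append
          multiset.map_comp comp_def)
  qed
qed

section \<open>Row lengths of the diagram\<close>

lemma rights_before_dyck_word_Cons:
  assumes "\<pi> \<noteq> []"
  shows "rights_before (dyck_word \<pi>) = 0 # tl (rights_before (dyck_word \<pi>))"
  using assms by (subst (1 2) dyck_word.simps) (simp add: Let_def)

lemma Lambda_eq_rights_before:
  assumes "distinct \<pi>"
  shows "Lambda \<pi> = rev (tl (rights_before (dyck_word \<pi>)))"
proof -
  let ?r = "rights_before (dyck_word \<pi>)"
  have len: "length ?r = length \<pi>"
    using dyck_word_left_borders[OF assms] mset_eq_length[of ?r "left_borders \<pi>"]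
    by (simp add: length_left_borders)
  \<comment> \<open>Leaving out row \<open>0\<close> amounts to dropping the record of the initial
    up step.\<close>
  have "map (\<lambda>y. card {x. (x, y) \<in> cells_above (dyck_word \<pi>)}) [1..<length \<pi>] = tl ?r"
    by (rule nth_equalityI) (simp_all add: len card_row_eq_rights_before nth_tl)
  then show ?thesis
    by (simp add: Lambda_def flip: rev_map)
qed

theorem proposition1p1:
  fixes n :: nat and \<pi> :: "nat list"
  assumes "n \<ge> 1" and "\<pi> \<in> permutations_of_set {1..n}"
  shows "Lambda \<pi> = rev (sort (map (left_border \<pi>) [2..<Suc n]))"
proof -
  let ?r = "rights_before (dyck_word \<pi>)"
  have dist: "distinct \<pi>" and len: "length \<pi> = n"
    using assms(2) length_finite_permutations_of_set[OF assms(2)]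
    by (auto dest: permutations_of_setD)
  have "\<pi> \<noteq> []"
    using assms(1) len by auto
  note r = rights_before_dyck_word_Cons[OF this]
  have "{m. 1 \<le> m \<and> m < 1 \<and> letter \<pi> m > letter \<pi> 1} = {}"
    by auto
  then have "left_border \<pi> 1 = 0"
    by (simp only: left_border_def) simp
  then have "left_borders \<pi> = 0 # map (left_border \<pi>) [2..<Suc n]"
    using assms(1) len
    by (simp add: left_borders_def upt_conv_Cons numeral_2_eq_2 del: upt_Suc)
  \<comment> \<open>Both lists start with \<open>0\<close>, from the initial up step and from
    position \<open>1\<close>; cancelling it leaves the multisets to be sorted.\<close>
  then have "mset (0 # tl ?r) = mset (0 # map (left_border \<pi>) [2..<Suc n])"
    using dyck_word_left_borders[OF dist] r by metis
  then have "mset (tl ?r) = mset (map (left_border \<pi>) [2..<Suc n])"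
    by simp
  moreover have "sorted (tl ?r)"
    by (intro sorted_tl sorted_rights_before)
  ultimately have "sort (map (left_border \<pi>) [2..<Suc n]) = tl ?r"
    by (rule properties_for_sort)
  then show ?thesis
    using Lambda_eq_rights_before[OF dist] by simp
qed

end
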